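(* Let $n,m,b\in\mathbb{Z}$ with $n\ge 3$, $|m|\ge 2$ and $b\ge 2$. Assume that $\gcd(b,m)=1$ and that $b$ is squarefree. Let $$\mathcal{D}:=\frac{n^n(1-bm^{2n})^{n+1}+bm^{2n}(n+1)^{n+1}}{(1+bm^{2n}n)^2}\in\mathbb{Z},$$ and assume that $$d:=\frac{|\mathcal{D}|}{\prod_{p\text{ prime},\ p\mid bm}p^{\nu_p(\mathcal{D})}}$$ is squarefree. If $\gcd(n,m)=1$, then the polynomial $$\mathcal{F}_{n,b,m,1}(x)=x^n+b\sum_{j=1}^{n}(m^2x)^{n-j}$$ is monogenic.
   Context: A monic polynomial $f(x)\in\mathbb{Z}[x]$ is called monogenic if $f(x)$ is irreducible over $\mathbb{Q}$ and $\{1,\theta,\theta^2,\ldots,\theta^{\deg(f)-1}\}$ is a basis (over $\mathbb{Z}$) for the ring of integers of $\mathbb{Q}(\theta)$, where $f(\theta)=0$. Here $\nu_p(z)$ denotes the $p$-adic valuation of the integer $z$. The quantity $\mathcal{D}$ is always an integer. In the sum, the term $j=n$ is $(m^2x)^0=1$. *)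

theory Defs
  imports "HOL-Computational_Algebra.Computational_Algebra"
begin

global_interpretation int_module: module "\<lambda>(k::int) (z::complex). of_int k * z"
  by unfold_locales (simp_all add: algebra_simps)

definition complex_subfield :: "complex set \<Rightarrow> bool" where
  "complex_subfield K \<longleftrightarrow> 0 \<in> K \<and> 1 \<in> K \<and>
     (\<forall>x\<in>K. \<forall>y\<in>K. x + y \<in> K \<and> x * y \<in> K) \<and>
     (\<forall>x\<in>K. - x \<in> K \<and> inverse x \<in> K)"

definition rat_adjoin :: "complex \<Rightarrow> complex set" where
  "rat_adjoin \<theta> = complex_subfield hull (insert \<theta> \<rat>)"

definition ring_of_integers :: "complex set \<Rightarrow> complex set" where
  "ring_of_integers K = {z \<in> K. algebraic_int z}"

text \<open>A basis is a family here: injectivity is required because \<open>independent\<close> and \<open>span\<close>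
  only see the set of its values.\<close>

definition int_basis :: "(nat \<Rightarrow> complex) \<Rightarrow> nat set \<Rightarrow> complex set \<Rightarrow> bool" where
  "int_basis v I M \<longleftrightarrow> inj_on v I \<and> int_module.independent (v ` I) \<and> int_module.span (v ` I) = M"

text \<open>The condition is imposed on every complex root \<open>\<theta>\<close>; an irreducible polynomial over
  \<open>\<rat>\<close> has positive degree, hence a complex root, so the quantifier is never vacuous.\<close>

definition monogenic :: "int poly \<Rightarrow> bool" where
  "monogenic f \<longleftrightarrow> lead_coeff f = 1 \<and> irreducible (map_poly rat_of_int f) \<and>
     (\<forall>\<theta>::complex. poly (map_poly of_int f) \<theta> = 0 \<longrightarrow>
        int_basis (\<lambda>i. \<theta> ^ i) {..<degree f} (ring_of_integers (rat_adjoin \<theta>)))"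

definition F_poly :: "nat \<Rightarrow> int \<Rightarrow> int \<Rightarrow> int poly" where
  "F_poly n b m = monom 1 n + smult b (\<Sum>j=1..n. monom (m ^ 2) 1 ^ (n - j))"

text \<open>The two integer divisions below are exact, see \<open>of_int_D_val\<close> and \<open>of_int_d_val\<close>.\<close>

definition D_val :: "nat \<Rightarrow> int \<Rightarrow> int \<Rightarrow> int" where
  "D_val n b m =
     (int n ^ n * (1 - b * m ^ (2 * n)) ^ (n + 1) + b * m ^ (2 * n) * (int n + 1) ^ (n + 1))
     div (1 + b * m ^ (2 * n) * int n) ^ 2"

definition d_val :: "nat \<Rightarrow> int \<Rightarrow> int \<Rightarrow> int" where
  "d_val n b m =
     \<bar>D_val n b m\<bar> div (\<Prod>p | prime p \<and> p dvd b * m. p ^ multiplicity p (D_val n b m))"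

lemma square_dvd_power_diff:
  fixes x u :: int
  shows "u ^ 2 dvd (x - u) ^ k - x ^ k + of_nat k * x ^ (k - 1) * u"
proof (induction k)
  case (Suc k)
  show ?case
  proof (cases k)
    case 0
    then show ?thesis by simp
  next
    case (Suc l)
    have "(x - u) ^ Suc k - x ^ Suc k + of_nat (Suc k) * x ^ (Suc k - 1) * u
      = (x - u) * ((x - u) ^ k - x ^ k + of_nat k * x ^ (k - 1) * u)
        + u ^ 2 * (of_nat k * x ^ (k - 1))"
      by (simp add: Suc algebra_simps power2_eq_square)
    then show ?thesis
      using Suc.IH by simp
  qed
qed simp

lemma D_val_dvd:
  fixes c :: int
  shows "(1 + c * int n) ^ 2 dvd int n ^ n * (1 - c) ^ (n + 1) + c * (int n + 1) ^ (n + 1)"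
    (is "?u ^ 2 dvd ?A")
proof -
  let ?N = "int n + 1"
  have "?u ^ 2 dvd (?N - ?u) ^ (n + 1) - ?N ^ (n + 1) + of_nat (n + 1) * ?N ^ n * ?u"
    using square_dvd_power_diff[of ?u ?N "n + 1"] by simp
  also have "?N - ?u = int n * (1 - c)"
    by (simp add: algebra_simps)
  also have "(int n * (1 - c)) ^ (n + 1) - ?N ^ (n + 1) + of_nat (n + 1) * ?N ^ n * ?u
      = int n * ?A"
  proof -
    have pow: "(int n * (1 - c)) ^ (n + 1) = int n * (int n ^ n * (1 - c) ^ (n + 1))"
      unfolding power_mult_distrib by simp
    show ?thesis
      unfolding pow by (simp add: algebra_simps)
  qed
  finally have "?u ^ 2 dvd int n * ?A" .
  moreover have "coprime (?u ^ 2) (int n)"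
  proof -
    have "gcd (int n) (c * int n + 1) = 1"
      using gcd_add_mult[of "int n" c 1] by simp
    then have "coprime (int n) ?u"
      by (simp add: coprime_iff_gcd_eq_1 add.commute)
    then show ?thesis
      by (simp add: coprime_commute)
  qed
  ultimately show ?thesis
    by (simp add: coprime_dvd_mult_right_iff)
qed

lemma of_int_D_val:
  "(of_int (D_val n b m) :: rat) =
     (of_nat n ^ n * (1 - of_int b * of_int m ^ (2 * n)) ^ (n + 1)
        + of_int b * of_int m ^ (2 * n) * (of_nat n + 1) ^ (n + 1))
     / (1 + of_int b * of_int m ^ (2 * n) * of_nat n) ^ 2"
  unfolding D_val_def using D_val_dvd[of "b * m ^ (2 * n)" n]
  by (subst of_int_div) (simp_all add: mult.assoc)

lemma d_val_dvd:
  "(\<Prod>p | prime p \<and> p dvd b * m. p ^ multiplicity p x) dvd \<bar>x :: int\<bar>" if "b * m \<noteq> 0"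
proof -
  have fin: "finite {p. prime p \<and> p dvd b * m}"
    using that finite_prime_divisors by blast
  have "(\<Prod>p\<in>P. p ^ multiplicity p x) dvd x" if "finite P" "\<forall>p\<in>P. prime p" for P
    using that
  proof (induction P)
    case (insert q P)
    have "coprime (q ^ multiplicity q x) (\<Prod>p\<in>P. p ^ multiplicity p x)"
      using insert by (intro prod_coprime_right) (auto intro: primes_coprime)
    then show ?case
      using insert by (simp add: divides_mult multiplicity_dvd)
  qed simp
  then show ?thesis
    using fin by simp
qed

lemma of_int_d_val:
  assumes "b * m \<noteq> 0"
  shows "(of_int (d_val n b m) :: rat) =
     of_int \<bar>D_val n b m\<bar> / of_int (\<Prod>p | prime p \<and> p dvd b * m. p ^ multiplicity p (D_val n b m))"
  unfolding d_val_def using d_val_dvd[OF assms] by (rule of_int_div)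

end

theory Submission
  imports
    Defs
    "HOL-Computational_Algebra.Field_as_Ring"
    "Jordan_Normal_Form.Char_Poly"
begin

hide_const (open) module.smult

text \<open>
  If a prime \<open>p\<close> divides the index of \<open>\<int>[\<theta>]\<close>, then Dedekind's criterion yields a prime ideal
  \<open>P\<close> of \<open>\<int>[x]\<close> with \<open>p \<in> P\<close> and \<open>f \<in> P\<^sup>2\<close>, so \<open>f\<close> and its derivative lie in \<open>P\<close>.
  If \<open>p\<close> divides \<open>b\<close>, then \<open>x \<in> P\<close> and \<open>p\<^sup>2\<close> divides \<open>f(0) = b\<close>. Otherwise put
  \<open>c = b m\<^sup>2\<^sup>n\<close>; differentiating the trinomial
  \<open>(m\<^sup>2 x - 1) f = m\<^sup>2 x\<^sup>n\<^sup>+\<^sup>1 - (1 - c) x\<^sup>n - b\<close> shows that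
  \<open>(n + 1) m\<^sup>2 x - n (1 - c)\<close> is in \<open>P\<close>. This is impossible for \<open>p\<close> dividing \<open>m\<close>. For \<open>p\<close>
  dividing \<open>n + 1\<close> it gives \<open>p\<close> dividing \<open>1 - c\<close>, hence \<open>p\<^sup>2\<close> dividing \<open>D\<close>. In the remaining case it
  determines a root \<open>r\<close> of \<open>f\<close> modulo \<open>p\<^sup>2\<close>, and substituting \<open>r\<close> in the trinomial again shows
  that \<open>p\<^sup>2\<close> divides \<open>D\<close>.
\<close>

section \<open>Algebraic integers form a ring\<close>

text \<open>The determinant trick: multiplication by \<open>x\<close> acts on the generators through
  an integer matrix, so \<open>x\<close> is a root of its monic characteristic polynomial.\<close>

lemma algebraic_int_if_span_stable:
  fixes x :: complex
  assumes "finite B" and "\<exists>b\<in>B. b \<noteq> 0"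
    and stable: "\<And>b. b \<in> B \<Longrightarrow> x * b \<in> int_module.span B"
  shows "algebraic_int x"
proof -
  obtain N v where v: "B = v ` {i::nat. i < N}" and inj: "inj_on v {i. i < N}"
    using \<open>finite B\<close> by (metis finite_imp_nat_seg_image_inj_on)
  have "\<exists>u. x * v i = (\<Sum>b\<in>B. of_int (u b) * b)" if "i < N" for i
    using stable[of "v i"] that int_module.span_finite[OF \<open>finite B\<close>] v by auto
  then obtain u where u: "\<And>i. i < N \<Longrightarrow> x * v i = (\<Sum>b\<in>B. of_int (u i b) * b)"
    by metis
  define A where "A = mat N N (\<lambda>(i, j). u i (v j))"
  \<comment> \<open>The vector of generators is the eigenvector for the eigenvalue
    \<open>x\<close>.\<close>
  define w where "w = vec N v"
  have A: "A \<in> carrier_mat N N" by (simp add: A_def)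
  have "map_mat of_int A *\<^sub>v w = x \<cdot>\<^sub>v w"
  proof (rule eq_vecI)
    fix i assume "i < dim_vec (x \<cdot>\<^sub>v w)"
    then have i: "i < N" by (simp add: w_def)
    have "(map_mat of_int A *\<^sub>v w) $ i = (\<Sum>j<N. of_int (u i (v j)) * v j)"
      using i by (simp add: A_def w_def scalar_prod_def atLeast0LessThan)
    also have "\<dots> = (\<Sum>b\<in>B. of_int (u i b) * b)"
      unfolding v using inj by (simp add: sum.reindex lessThan_def)
    finally show "(map_mat of_int A *\<^sub>v w) $ i = (x \<cdot>\<^sub>v w) $ i"
      using u[OF i] i by (simp add: w_def)
  qed (simp add: A_def w_def)
  moreover have "w \<noteq> 0\<^sub>v N"
    using assms(2) by (auto simp: v w_def vec_eq_iff)
  ultimately have "eigenvalue (map_mat of_int A) x"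
    unfolding eigenvalue_def eigenvector_def by (intro exI[of _ w]) (auto simp: A_def w_def)
  then have "poly (map_poly of_int (char_poly A)) x = 0"
    using A by (simp add: eigenvalue_root_char_poly[of _ N] of_int_hom.char_poly_hom)
  moreover have "lead_coeff (char_poly A) = 1"
    using degree_monic_char_poly[OF A] by simp
  ultimately show ?thesis
    unfolding algebraic_int_altdef_ipoly by blast
qed

lemma monic_root_power_in_span:
  fixes x :: complex
  assumes "lead_coeff p = 1" and "poly (map_poly of_int p) x = 0"
  shows "x ^ degree p \<in> int_module.span ((^) x ` {..<degree p})"
proof -
  have "0 = (\<Sum>k\<le>degree p. of_int (coeff p k) * x ^ k)"
    using assms(2) by (simp add: poly_altdef)
  also have "\<dots> = x ^ degree p + (\<Sum>k<degree p. of_int (coeff p k) * x ^ k)"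
    using assms(1) by (simp flip: lessThan_Suc_atMost)
  finally have "x ^ degree p = - (\<Sum>k<degree p. of_int (coeff p k) * x ^ k)"
    by (simp add: eq_neg_iff_add_eq_0)
  also have "\<dots> \<in> int_module.span ((^) x ` {..<degree p})"
    by (intro int_module.span_neg int_module.span_sum int_module.span_scale int_module.span_base) auto
  finally show ?thesis .
qed

lemma span_mult_closed:
  assumes "\<And>b. b \<in> B \<Longrightarrow> x * b \<in> int_module.span B" and "z \<in> int_module.span B"
  shows "x * z \<in> int_module.span B"
  using assms(2)
proof (induction rule: int_module.span_induct_alt)
  case (step c b z)
  have "x * (of_int c * b + z) = of_int c * (x * b) + x * z"
    by (simp add: algebra_simps)
  then show ?case
    using step assms(1) by (simp add: int_module.span_add int_module.span_scale)
qed (simp add: int_module.span_zero)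

text \<open>The products \<open>x ^ i * y ^ j\<close> with exponents below the two degrees span a
  module stable under \<open>x\<close> and \<open>y\<close>, hence under their sum and
  product.\<close>

lemma
  fixes x y :: complex
  assumes "algebraic_int x" and "algebraic_int y"
  shows algebraic_int_add: "algebraic_int (x + y)"
    and algebraic_int_mult: "algebraic_int (x * y)"
proof -
  obtain p q where p: "lead_coeff p = 1" "poly (map_poly of_int p) x = 0"
    and q: "lead_coeff q = 1" "poly (map_poly of_int q) y = 0"
    using assms unfolding algebraic_int_altdef_ipoly by blast
  define B where "B = (\<lambda>(i, j). x ^ i * y ^ j) ` ({..<degree p} \<times> {..<degree q})"
  \<comment> \<open>Positive degrees put \<open>x ^ 0 * y ^ 0 = 1\<close> among the products, which
    supplies the non-zero generator.\<close>
  have pos: "degree r > 0" if "lead_coeff r = 1" "poly (map_poly of_int r) z = 0"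
    for r :: "int poly" and z :: complex
  proof (rule ccontr)
    assume "\<not> degree r > 0"
    then have "r = 1" using that(1) by (metis degree_eq_zeroE gr0I lead_coeff_pCons(2) one_pCons)
    then show False using that(2) by simp
  qed
  have B_mono: "z * w \<in> int_module.span B"
    if "z \<in> int_module.span ((^) x ` {..<degree p})" "w \<in> (^) y ` {..<degree q}" for z w
    using that(1)
  proof (induction rule: int_module.span_induct_alt)
    case (step c b z)
    have "of_int c * (b * w) \<in> int_module.span B"
      using step that(2) unfolding B_def
      by (intro int_module.span_scale int_module.span_base) auto
    then show ?case
      using step int_module.span_add by (simp add: algebra_simps)
  qed (simp add: int_module.span_zero)
  have B_mono': "w * z \<in> int_module.span B"
    if "z \<in> int_module.span ((^) y ` {..<degree q})" "w \<in> (^) x ` {..<degree p}" for z w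
    using that(1)
  proof (induction rule: int_module.span_induct_alt)
    case (step c b z)
    have "of_int c * (w * b) \<in> int_module.span B"
      using step that(2) unfolding B_def
      by (intro int_module.span_scale int_module.span_base) auto
    then show ?case
      using step int_module.span_add by (simp add: algebra_simps)
  qed (simp add: int_module.span_zero)
  have next_power: "z ^ Suc i \<in> int_module.span ((^) z ` {..<degree r})"
    if "lead_coeff r = 1" "poly (map_poly of_int r) z = 0" "i < degree r"
    for r :: "int poly" and z :: complex and i
  proof (cases "Suc i = degree r")
    case True
    then show ?thesis using monic_root_power_in_span[OF that(1,2)] by simp
  next
    case False
    then show ?thesis using that(3) by (intro int_module.span_base image_eqI[of _ _ "Suc i"]) auto
  qed
  have xB: "x * b \<in> int_module.span B" if b: "b \<in> B" for b
  proof -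
    obtain i j where ij: "b = x ^ i * y ^ j" "i < degree p" "j < degree q"
      using b unfolding B_def by auto
    show ?thesis
      using B_mono[OF next_power[OF p ij(2)], of "y ^ j"] ij by (simp add: mult.assoc)
  qed
  have yB: "y * b \<in> int_module.span B" if b: "b \<in> B" for b
  proof -
    obtain i j where ij: "b = x ^ i * y ^ j" "i < degree p" "j < degree q"
      using b unfolding B_def by auto
    show ?thesis
      using B_mono'[OF next_power[OF q ij(3)], of "x ^ i"] ij by (simp add: mult.left_commute)
  qed
  have fin: "finite B" by (simp add: B_def)
  have "1 \<in> B"
    unfolding B_def by (rule image_eqI[of _ _ "(0, 0)"]) (use pos[OF p] pos[OF q] in auto)
  then have nz: "\<exists>b\<in>B. b \<noteq> 0" by (intro bexI[of _ 1]) simp_all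
  show "algebraic_int (x + y)"
    using fin nz by (rule algebraic_int_if_span_stable)
      (simp add: distrib_right int_module.span_add xB yB)
  show "algebraic_int (x * y)"
    using fin nz by (rule algebraic_int_if_span_stable)
      (simp add: mult.assoc span_mult_closed[OF xB] yB)
qed

section \<open>Ideals of the integer polynomials\<close>

definition ring_ideal :: "'a::comm_ring_1 set \<Rightarrow> bool" where
  "ring_ideal I \<longleftrightarrow> 0 \<in> I \<and> (\<forall>a\<in>I. \<forall>b\<in>I. a + b \<in> I) \<and> (\<forall>a\<in>I. \<forall>r. r * a \<in> I)"

definition prime_ring_ideal :: "'a::comm_ring_1 set \<Rightarrow> bool" where
  "prime_ring_ideal P \<longleftrightarrow> ring_ideal P \<and> 1 \<notin> P \<and> (\<forall>a b. a * b \<in> P \<longrightarrow> a \<in> P \<or> b \<in> P)"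

lemma ring_ideal_zero: "ring_ideal I \<Longrightarrow> 0 \<in> I"
  and ring_ideal_add: "ring_ideal I \<Longrightarrow> a \<in> I \<Longrightarrow> b \<in> I \<Longrightarrow> a + b \<in> I"
  and ring_ideal_mult_left: "ring_ideal I \<Longrightarrow> a \<in> I \<Longrightarrow> r * a \<in> I"
  by (auto simp: ring_ideal_def)

lemma ring_ideal_mult_right: "ring_ideal I \<Longrightarrow> a \<in> I \<Longrightarrow> a * r \<in> I"
  using ring_ideal_mult_left by (metis mult.commute)

lemma ring_ideal_diff: "ring_ideal I \<Longrightarrow> a \<in> I \<Longrightarrow> b \<in> I \<Longrightarrow> a - b \<in> I"
  using ring_ideal_add[of I a "- b"] ring_ideal_mult_left[of I b "- 1"] by simp

lemma prime_ring_ideal_mult: "prime_ring_ideal P \<Longrightarrow> a * b \<in> P \<Longrightarrow> a \<in> P \<or> b \<in> P"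
  by (auto simp: prime_ring_ideal_def)

lemma prime_ring_ideal_power: "prime_ring_ideal P \<Longrightarrow> a ^ k \<in> P \<Longrightarrow> a \<in> P"
  by (induction k) (auto simp: prime_ring_ideal_def)

text \<open>Zorn's lemma gives an ideal maximal among the proper ideals containing \<open>I\<close>,
  and maximality makes it prime.\<close>

lemma prime_ring_ideal_exists:
  assumes "ring_ideal I" and "1 \<notin> I"
  obtains P where "prime_ring_ideal P" and "I \<subseteq> P"
proof -
  define \<A> where "\<A> = {J. ring_ideal J \<and> 1 \<notin> J \<and> I \<subseteq> J}"
  have "\<Union>C \<in> \<A>" if "C \<noteq> {}" and chain: "subset.chain \<A> C" for C
  proof -
    have sub: "C \<subseteq> \<A>" and comp: "\<And>X Y. X \<in> C \<Longrightarrow> Y \<in> C \<Longrightarrow> X \<subseteq> Y \<or> Y \<subseteq> X"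
      using chain by (auto simp: subset_chain_def)
    have "ring_ideal (\<Union>C)"
      unfolding ring_ideal_def
    proof (intro conjI ballI allI)
      show "0 \<in> \<Union>C" using \<open>C \<noteq> {}\<close> sub ring_ideal_zero by (auto simp: \<A>_def)
    next
      fix a b assume "a \<in> \<Union>C" "b \<in> \<Union>C"
      then obtain X where "X \<in> C" "a \<in> X" "b \<in> X" using comp by blast
      moreover from this have "ring_ideal X" using sub by (auto simp: \<A>_def)
      ultimately show "a + b \<in> \<Union>C" using ring_ideal_add by blast
    next
      fix a r assume "a \<in> \<Union>C"
      then show "r * a \<in> \<Union>C" using sub ring_ideal_mult_left by (fastforce simp: \<A>_def)
    qed
    then show ?thesis using \<open>C \<noteq> {}\<close> sub by (auto simp: \<A>_def)
  qed
  moreover have "I \<in> \<A>" using assms by (simp add: \<A>_def)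
  ultimately obtain M where "M \<in> \<A>" and max: "\<And>X. X \<in> \<A> \<Longrightarrow> M \<subseteq> X \<Longrightarrow> X = M"
    using subset_Zorn_nonempty[of \<A>] by (metis empty_iff)
  then have M: "ring_ideal M" "1 \<notin> M" "I \<subseteq> M" by (auto simp: \<A>_def)
  have "a \<in> M \<or> b \<in> M" if ab: "a * b \<in> M" for a b
  proof (rule ccontr)
    assume neg: "\<not> ?thesis"
    \<comment> \<open>The ideal generated by \<open>M\<close> and \<open>a\<close> strictly exceeds
      \<open>M\<close>, so it contains 1; multiplying that representation of 1 by \<open>b\<close>
      puts \<open>b\<close> into \<open>M\<close>.\<close>
    define N where "N = {x + r * a | x r. x \<in> M}"
    have "ring_ideal N"
      unfolding ring_ideal_def
    proof (intro conjI ballI allI)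
      show "0 \<in> N" using ring_ideal_zero[OF M(1)] unfolding N_def
        by (intro CollectI exI[of _ 0]) simp
    next
      fix u v assume "u \<in> N" "v \<in> N"
      then obtain x r y s where "u = x + r * a" "v = y + s * a" "x \<in> M" "y \<in> M"
        by (auto simp: N_def)
      then have "u + v = (x + y) + (r + s) * a" "x + y \<in> M"
        using ring_ideal_add[OF M(1)] by (auto simp: algebra_simps)
      then show "u + v \<in> N" unfolding N_def by blast
    next
      fix u s assume "u \<in> N"
      then obtain x r where "u = x + r * a" "x \<in> M" by (auto simp: N_def)
      then have "s * u = s * x + (s * r) * a" "s * x \<in> M"
        using M(1) by (simp_all add: distrib_left mult.assoc ring_ideal_mult_left)
      then show "s * u \<in> N" unfolding N_def by blast
    qed
    moreover have "M \<subseteq> N"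
    proof
      fix x assume "x \<in> M"
      then show "x \<in> N" unfolding N_def by (intro CollectI exI[of _ x] exI[of _ 0]) simp
    qed
    moreover have "a \<in> N"
      unfolding N_def using ring_ideal_zero[OF M(1)]
      by (intro CollectI exI[of _ 0] exI[of _ 1]) simp
    ultimately have "1 \<in> N"
      using max[of N] neg M(3) by (auto simp: \<A>_def)
    then obtain x r where x: "1 = x + r * a" "x \<in> M" by (auto simp: N_def)
    have "b = x * b + r * (a * b)"
      using arg_cong[OF x(1), of "\<lambda>y. y * b"] by (simp add: algebra_simps)
    also have "\<dots> \<in> M"
      using M(1) x(2) ab by (simp add: ring_ideal_add ring_ideal_mult_left ring_ideal_mult_right)
    finally show False using neg by simp
  qed
  then have "prime_ring_ideal M" using M by (simp add: prime_ring_ideal_def)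
  then show thesis using that M(3) by blast
qed

section \<open>Monic division and ideals modulo a prime\<close>

lemma monic_division:
  fixes k w :: "'a::idom poly"
  assumes "lead_coeff k = 1"
  obtains q r where "w = k * q + r" and "r = 0 \<or> degree r < degree k"
proof -
  obtain q r where qr: "pseudo_divmod w k = (q, r)" by fastforce
  have "k \<noteq> 0" using assms by auto
  \<comment> \<open>Pseudo-division scales \<open>w\<close> by a power of the leading coefficient of
    \<open>k\<close>, which is 1.\<close>
  from pseudo_divmod[OF this qr] show thesis using that assms by auto
qed

text \<open>Over the field \<open>\<int>/p\<close> this says that an ideal is generated by an element of least degree.\<close>

lemma least_degree_monic_in_ideal:
  fixes p :: int
  assumes "prime p" and I: "ring_ideal I" "[:p:] \<in> I" and "g \<in> I" "lead_coeff g = 1"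
  obtains k where "k \<in> I" and "lead_coeff k = 1"
    and "\<And>w. w \<in> I \<Longrightarrow> degree w < degree k \<Longrightarrow> [:p:] dvd w"
proof -
  define k where "k = arg_min degree (\<lambda>w. w \<in> I \<and> lead_coeff w = 1)"
  have k: "k \<in> I \<and> lead_coeff k = 1"
    unfolding k_def by (rule arg_min_natI[of _ g]) (use assms in simp)
  have least: "degree k \<le> degree w" if "w \<in> I" "lead_coeff w = 1" for w
    unfolding k_def by (rule arg_min_nat_le) (use that in simp)
  have "[:p:] dvd w" if "w \<in> I" "degree w < degree k" for w
    using that
  proof (induction "degree w" arbitrary: w rule: less_induct)
    case less
    let ?c = "lead_coeff w" and ?d = "degree w"
    show ?case
    proof (cases "p dvd ?c")
      case True
      then obtain e where e: "?c = p * e" by (elim dvdE)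
      \<comment> \<open>Subtracting a multiple of \<open>p\<close> that cancels the leading term
        stays inside \<open>I\<close> and lowers the degree.\<close>
      define w' where "w' = w - monom e ?d * [:p:]"
      have split: "w = w' + [:p:] * monom e ?d" by (simp add: w'_def)
      have w'I: "w' \<in> I"
        unfolding w'_def using less I by (intro ring_ideal_diff ring_ideal_mult_left)
      show ?thesis
      \<comment> \<open>For a constant the degree cannot drop, so this case is settled
        directly.\<close>
      proof (cases "?d = 0")
        case True
        then obtain a where "w = [:a:]" by (metis degree_eq_zeroE)
        then show ?thesis using e by simp
      next
        case False
        have "coeff w' i = 0" if "i \<ge> ?d" for i
          using that e by (cases "i = ?d") (auto simp: w'_def coeff_eq_0)
        then have "degree w' \<le> ?d - 1"
          by (intro degree_le) (metis False One_nat_def Suc_leI bot_nat_0.not_eq_extremum le_simps(2) Suc_pred not_less)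
        then have "degree w' < ?d" using False by simp
        then have "[:p:] dvd w'" using less w'I by (metis dual_order.strict_trans)
        then show ?thesis using split by (metis dvd_add dvd_triv_left)
      qed
    next
      case False
      then have "coprime p ?c" using \<open>prime p\<close> by (simp add: prime_imp_coprime)
      \<comment> \<open>The leading coefficient is invertible modulo \<open>p\<close>, so
        \<open>w\<close> and \<open>p\<close> times a monomial combine to a monic element of
        \<open>I\<close> of degree below that of \<open>k\<close>, against minimality.\<close>
      then obtain s t where st: "s * ?c + t * p = 1"
        by (metis bezout_int coprime_commute coprime_imp_gcd_eq_1)
      define v where "v = [:s:] * w + monom t ?d * [:p:]"
      have "v \<in> I"
        unfolding v_def using less I by (intro ring_ideal_add ring_ideal_mult_left)
      moreover have "coeff v ?d = 1" using st by (simp add: v_def mult_ac)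
      moreover have "degree v \<le> ?d"
        by (intro degree_le) (auto simp: v_def coeff_eq_0)
      ultimately have "lead_coeff v = 1" "degree v \<le> ?d"
        by (metis dual_order.antisym le_degree zero_neq_one)+
      then show ?thesis using least[OF \<open>v \<in> I\<close>] less by simp
    qed
  qed
  then show thesis using that k by blast
qed

section \<open>Passing between integer and rational polynomials\<close>

lemma int_poly_clear_denominators:
  obtains d :: int and g :: "int poly"
  where "d \<noteq> 0" and "smult (of_int d) q = map_poly rat_of_int g"
proof -
  have "\<exists>d g. d \<noteq> 0 \<and> smult (of_int d) q = map_poly rat_of_int g"
  proof (induction q)
    case 0
    show ?case by (intro exI[of _ 1] exI[of _ 0]) simp
  next
    case (pCons a q)
    then obtain d g where dg: "d \<noteq> 0" "smult (of_int d) q = map_poly rat_of_int g" by blast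
    obtain u v where uv: "a = of_int u / of_int v" "v > 0"
      by (metis Fract_of_int_quotient Rat_cases)
    have "smult (of_int (v * d)) (pCons a q) = pCons (of_int (d * u)) (smult (of_int v) (smult (of_int d) q))"
      using uv by simp
    also have "\<dots> = map_poly rat_of_int (pCons (d * u) (smult v g))"
      unfolding dg(2) by (simp add: map_poly_pCons hom_distribs)
    finally show ?case using uv dg by (metis less_irrefl mult_eq_0_iff)
  qed
  then show thesis using that by blast
qed

text \<open>Gauss's lemma: \<open>f\<close> is a prime element of the factorial ring of integer
  polynomials. Clearing denominators in a rational factorization makes \<open>f\<close> divide one
  of the two integral factors, and comparing degrees leaves the other one constant.\<close>

lemma irreducible_map_poly_rat_of_int:
  fixes f :: "int poly"
  assumes irr: "irreducible f" and deg: "degree f > 0"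
  shows "irreducible (map_poly rat_of_int f)"
proof (rule irreducibleI)
  show "map_poly rat_of_int f \<noteq> 0" using deg by auto
  show "\<not> is_unit (map_poly rat_of_int f)" using deg by (auto simp: is_unit_iff_degree)
  have prime: "prime_elem f" using irr by (rule irreducible_imp_prime_poly)
  fix A B assume AB: "map_poly rat_of_int f = A * B"
  then have nz: "A \<noteq> 0" "B \<noteq> 0" using deg by auto
  then have degAB: "degree A + degree B = degree f"
    using arg_cong[OF AB, of degree] by (simp add: degree_mult_eq)
  obtain a A' where A': "a \<noteq> 0" "smult (of_int a) A = map_poly rat_of_int A'"
    by (rule int_poly_clear_denominators)
  obtain b B' where B': "b \<noteq> 0" "smult (of_int b) B = map_poly rat_of_int B'"
    by (rule int_poly_clear_denominators)
  have "map_poly rat_of_int (smult (a * b) f) = map_poly rat_of_int (A' * B')"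
    by (simp add: hom_distribs AB A'(2)[symmetric] B'(2)[symmetric] mult.commute)
  then have "smult (a * b) f = A' * B'" by simp
  then have "f dvd A' * B'" by (metis dvd_smult dvd_refl)
  then have "f dvd A' \<or> f dvd B'" using prime by (simp add: prime_elem_dvd_mult_iff)
  moreover have "degree A' = degree A" "degree B' = degree B"
    using A' B' by (metis degree_smult_eq of_int_eq_0_iff of_int_hom.degree_map_poly_hom)+
  moreover have "A' \<noteq> 0" "B' \<noteq> 0"
    using A' B' nz by auto
  ultimately have "degree A = 0 \<or> degree B = 0"
    using degAB by (auto dest!: dvd_imp_degree_le)
  then show "is_unit A \<or> is_unit B" using nz by (simp add: is_unit_iff_degree)
qed

text \<open>Over the rationals an irreducible polynomial is coprime to whatever it does not divide;
  \<open>d\<close> is the common denominator of the Bezout coefficients.\<close>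

lemma int_poly_bezout:
  fixes f w :: "int poly"
  assumes irr: "irreducible (map_poly rat_of_int f)" and ndvd: "\<not> map_poly rat_of_int f dvd map_poly rat_of_int w"
  obtains u v d where "d \<noteq> 0" and "u * f + v * w = [:d:]"
proof -
  let ?F = "map_poly rat_of_int f" and ?W = "map_poly rat_of_int w"
  have "prime_elem ?F" using irr by (rule field_poly_irreducible_imp_prime)
  then have "coprime ?F ?W" using ndvd by (rule prime_elem_imp_coprime)
  then obtain U V where UV: "U * ?F + V * ?W = 1"
    by (metis bezout_coefficients_fst_snd coprime_imp_gcd_eq_1)
  obtain a u where u: "a \<noteq> 0" "smult (of_int a) U = map_poly rat_of_int u"
    by (rule int_poly_clear_denominators)
  obtain b v where v: "b \<noteq> 0" "smult (of_int b) V = map_poly rat_of_int v"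
    by (rule int_poly_clear_denominators)
  have "map_poly rat_of_int (smult b u * f + smult a v * w) = smult (of_int (a * b)) (U * ?F + V * ?W)"
    by (simp add: hom_distribs u(2)[symmetric] v(2)[symmetric] smult_add_right mult_ac)
  also have "\<dots> = map_poly rat_of_int [:a * b:]"
    unfolding UV by (simp add: poly_eq_iff coeff_map_poly coeff_pCons split: nat.split)
  finally have "smult b u * f + smult a v * w = [:a * b:]" by simp
  then show thesis using that[of "a * b" "smult b u" "smult a v"] u v by simp
qed

section \<open>Dedekind's criterion\<close>

text \<open>The range of this ring homomorphism is \<int>[\<theta>], so elements of that ring are
  handled through polynomial representatives.\<close>

definition int_eval :: "complex \<Rightarrow> int poly \<Rightarrow> complex" where
  "int_eval \<theta> w = poly (map_poly of_int w) \<theta>"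

lemma int_eval_simps [simp]:
  "int_eval \<theta> 0 = 0"
  "int_eval \<theta> 1 = 1"
  "int_eval \<theta> (pCons c v) = of_int c + \<theta> * int_eval \<theta> v"
  "int_eval \<theta> (v + w) = int_eval \<theta> v + int_eval \<theta> w"
  "int_eval \<theta> (v - w) = int_eval \<theta> v - int_eval \<theta> w"
  "int_eval \<theta> (- v) = - int_eval \<theta> v"
  "int_eval \<theta> (v * w) = int_eval \<theta> v * int_eval \<theta> w"
  "int_eval \<theta> (smult c v) = of_int c * int_eval \<theta> v"
  "int_eval \<theta> (v ^ k) = int_eval \<theta> v ^ k"
  "int_eval \<theta> (monom c k) = of_int c * \<theta> ^ k"
  by (simp_all add: int_eval_def hom_distribs map_poly_pCons poly_monom)

lemma int_eval_sum [simp]: "int_eval \<theta> (\<Sum>i\<in>A. w i) = (\<Sum>i\<in>A. int_eval \<theta> (w i))"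
  by (simp add: int_eval_def hom_distribs poly_sum)

lemma int_eval_altdef: "int_eval \<theta> w = (\<Sum>i\<le>degree w. of_int (coeff w i) * \<theta> ^ i)"
  by (simp add: int_eval_def poly_altdef)

lemma algebraic_int_iff_int_eval:
  "algebraic_int \<theta> \<longleftrightarrow> (\<exists>p. int_eval \<theta> p = 0 \<and> lead_coeff p = 1)"
  unfolding algebraic_int_altdef_ipoly int_eval_def ..

lemma algebraic_int_int_eval: "algebraic_int \<theta> \<Longrightarrow> algebraic_int (int_eval \<theta> w)"
  by (induction w) (simp_all add: algebraic_int_add algebraic_int_mult)

locale monic_irreducible_root =
  fixes f :: "int poly" and \<theta> :: complex
  assumes monic: "lead_coeff f = 1"
    and irreducible: "irreducible (map_poly rat_of_int f)"
    and root: "int_eval \<theta> f = 0"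
begin

lemma algebraic_int_root: "algebraic_int \<theta>"
  using monic root algebraic_int_iff_int_eval by blast

lemma degree_pos: "degree f > 0"
proof (rule ccontr)
  assume "\<not> degree f > 0"
  then have "f = 1" using monic by (metis degree_eq_zeroE gr0I lead_coeff_pCons(2) one_pCons)
  then show False using irreducible by simp
qed

text \<open>Over the rationals, a Bezout identity evaluated at \<theta> would equate 0 with a
  non-zero integer. Division with remainder by the monic \<open>f\<close> transfers divisibility to
  the integers.\<close>

lemma root_imp_dvd:
  assumes "int_eval \<theta> w = 0"
  shows "f dvd w"
proof -
  have rat_dvd: "map_poly rat_of_int f dvd map_poly rat_of_int w" if "int_eval \<theta> w = 0" for w
  proof (rule ccontr)
    assume "\<not> ?thesis"
    then obtain u v d where "d \<noteq> 0" "u * f + v * w = [:d:]"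
      using int_poly_bezout[OF irreducible] by blast
    then have "int_eval \<theta> (u * f + v * w) = of_int d" by simp
    then show False using root that \<open>d \<noteq> 0\<close> by simp
  qed
  obtain q r where qr: "w = f * q + r" "r = 0 \<or> degree r < degree f"
    using monic by (rule monic_division)
  \<comment> \<open>The remainder also vanishes at \<theta>, but its degree is too small for a
    non-zero multiple of \<open>f\<close>.\<close>
  have "int_eval \<theta> r = 0" using assms root qr(1) by simp
  then have "map_poly rat_of_int f dvd map_poly rat_of_int r" by (rule rat_dvd)
  then have "r = 0 \<or> degree f \<le> degree r"
    by (auto dest: dvd_imp_degree_le)
  then show ?thesis using qr by auto
qed

lemma int_eval_eq_0_iff_small:
  "degree w < degree f \<Longrightarrow> int_eval \<theta> w = 0 \<longleftrightarrow> w = 0"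
  using root_imp_dvd[of w] dvd_imp_degree_le[of f w] by auto

lemma int_eval_reduce:
  obtains r where "degree r < degree f" and "int_eval \<theta> r = int_eval \<theta> w"
proof -
  obtain q r where qr: "w = f * q + r" "r = 0 \<or> degree r < degree f"
    using monic by (rule monic_division)
  then show thesis using that[of r] root degree_pos by auto
qed

text \<open>Multiply the monic equation of \<open>z\<close> by the \<open>N\<close>-th power of
  \<open>l(\<theta>)\<close>: the leading term becomes the \<open>N\<close>-th power of
  \<open>t(\<theta>)\<close>, and every other term keeps a factor \<open>l(\<theta>)\<close>. Thus a
  prime ideal containing \<open>f\<close> and \<open>l\<close> also contains
  \<open>t\<close>.\<close>

lemma algebraic_int_quotient_dvd:
  assumes "algebraic_int z" and "int_eval \<theta> t = z * int_eval \<theta> l"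
  obtains N q where "f dvd t ^ N - l * q"
proof -
  obtain c where c: "int_eval z c = 0" "lead_coeff c = 1"
    using assms(1) algebraic_int_iff_int_eval by blast
  let ?N = "degree c"
  define q where "q = - (\<Sum>i<?N. smult (coeff c i) (t ^ i * l ^ (?N - Suc i)))"
  let ?L = "int_eval \<theta> l" and ?T = "int_eval \<theta> t"
  have "0 = (\<Sum>i\<le>?N. of_int (coeff c i) * z ^ i) * ?L ^ ?N"
    using c(1) by (simp add: int_eval_altdef)
  also have "\<dots> = (\<Sum>i\<le>?N. of_int (coeff c i) * (?T ^ i * ?L ^ (?N - i)))"
    unfolding sum_distrib_right
  proof (rule sum.cong)
    fix i assume "i \<in> {..?N}"
    then have "?L ^ ?N = ?L ^ i * ?L ^ (?N - i)" by (simp flip: power_add)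
    then show "of_int (coeff c i) * z ^ i * ?L ^ ?N = of_int (coeff c i) * (?T ^ i * ?L ^ (?N - i))"
      unfolding assms(2) power_mult_distrib by (simp add: mult_ac)
  qed simp
  also have "\<dots> = ?T ^ ?N + (\<Sum>i<?N. of_int (coeff c i) * (?T ^ i * ?L ^ (?N - i)))"
    using c(2) by (simp flip: lessThan_Suc_atMost)
  also have "(\<Sum>i<?N. of_int (coeff c i) * (?T ^ i * ?L ^ (?N - i)))
      = ?L * (\<Sum>i<?N. of_int (coeff c i) * (?T ^ i * ?L ^ (?N - Suc i)))"
    unfolding sum_distrib_left
  proof (rule sum.cong)
    fix i assume "i \<in> {..<?N}"
    then have "?L ^ (?N - i) = ?L * ?L ^ (?N - Suc i)" by (simp add: Suc_diff_Suc flip: power_Suc)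
    then show "of_int (coeff c i) * (?T ^ i * ?L ^ (?N - i))
        = ?L * (of_int (coeff c i) * (?T ^ i * ?L ^ (?N - Suc i)))"
      by (simp add: mult_ac)
  qed simp
  finally have "int_eval \<theta> (t ^ ?N - l * q) = 0"
    by (simp add: q_def)
  then show thesis using root_imp_dvd that by blast
qed

text \<open>This is the direction of Dedekind's criterion saying that \<open>f\<close> lies in the square of a prime
  ideal above \<open>p\<close> whenever \<open>p\<close> divides the index. The ideal \<open>J\<close> of the numerators of integral
  elements with denominator \<open>p\<close> is generated modulo \<open>p\<close> by \<open>k\<close>, and \<open>P\<close> is a prime ideal
  above \<open>p\<close> and the cofactor \<open>l\<close>.\<close>

lemma dedekind_criterion:
  fixes p :: int
  assumes p: "prime p" and h: "algebraic_int (int_eval \<theta> h / of_int p)"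
    and deg_h: "degree h < degree f" and ndvd: "\<not> [:p:] dvd h"
  obtains P k l t where "prime_ring_ideal P" and "[:p:] \<in> P" and "k \<in> P" and "l \<in> P" and "t \<in> P"
    and "f = k * l + [:p:] * t"
proof -
  define J where "J = {w. algebraic_int (int_eval \<theta> w / of_int p)}"
  have p0: "p \<noteq> 0" using p by auto
  have "ring_ideal J"
    unfolding ring_ideal_def
  proof (intro conjI ballI allI)
    show "0 \<in> J" by (simp add: J_def)
  next
    fix a b assume "a \<in> J" "b \<in> J"
    then show "a + b \<in> J" by (simp add: J_def add_divide_distrib algebraic_int_add)
  next
    fix a r assume "a \<in> J"
    then show "r * a \<in> J"
      using algebraic_int_mult[OF algebraic_int_int_eval[OF algebraic_int_root], of "int_eval \<theta> a / of_int p" r]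
      by (simp add: J_def)
  qed
  moreover have pJ: "[:p:] \<in> J" using p0 by (simp add: J_def)
  moreover have fJ: "f \<in> J" by (simp add: J_def root)
  ultimately obtain k where k: "k \<in> J" "lead_coeff k = 1"
    and small: "\<And>w. w \<in> J \<Longrightarrow> degree w < degree k \<Longrightarrow> [:p:] dvd w"
    using least_degree_monic_in_ideal[OF p _ _ _ monic] by metis
  \<comment> \<open>Otherwise \<open>h\<close> would have degree below that of \<open>k\<close>, and
    \<open>p\<close> would divide it.\<close>
  have deg_k: "degree k < degree f"
    using small[of h] h deg_h ndvd by (force simp: J_def)
  obtain l r where lr: "f = k * l + r" "r = 0 \<or> degree r < degree k"
    using k(2) by (rule monic_division)
  \<comment> \<open>The remainder lies in \<open>J\<close> and is zero or of degree below that of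
    \<open>k\<close>, hence it is a multiple of \<open>p\<close>.\<close>
  have "r = f - k * l" using lr(1) by simp
  then have "r \<in> J"
    using \<open>ring_ideal J\<close> fJ k(1) by (simp add: ring_ideal_diff ring_ideal_mult_right)
  then obtain t where t: "r = [:p:] * t"
    using lr(2) small by (metis dvdE dvd_0_right)
  define \<kappa> where "\<kappa> = int_eval \<theta> k / of_int p"
  have \<kappa>: "algebraic_int \<kappa>" using k(1) by (simp add: J_def \<kappa>_def)
  have ev_k: "int_eval \<theta> k = of_int p * \<kappa>" using p0 by (simp add: \<kappa>_def)
  \<comment> \<open>Evaluate \<open>f = k * l + [:p:] * t\<close> at \<theta> and cancel
    \<open>p\<close>.\<close>
  have ev_t: "int_eval \<theta> t = - \<kappa> * int_eval \<theta> l"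
  proof -
    have "of_int p * (\<kappa> * int_eval \<theta> l + int_eval \<theta> t) = int_eval \<theta> f"
      unfolding lr(1) t by (simp add: ev_k algebra_simps)
    then show ?thesis using root p0 by (simp add: eq_neg_iff_add_eq_0 add.commute)
  qed
  define I where "I = {a * l + b * [:p:] | a b. True}"
  have "ring_ideal I"
    unfolding ring_ideal_def
  proof (intro conjI ballI allI)
    show "0 \<in> I" unfolding I_def by (intro CollectI exI[of _ 0]) simp
  next
    fix u v assume "u \<in> I" "v \<in> I"
    then obtain a b c d where "u = a * l + b * [:p:]" "v = c * l + d * [:p:]" by (auto simp: I_def)
    then have "u + v = (a + c) * l + (b + d) * [:p:]" by (simp only: algebra_simps)
    then show "u + v \<in> I" unfolding I_def by blast
  next
    fix u s assume "u \<in> I"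
    then obtain a b where "u = a * l + b * [:p:]" by (auto simp: I_def)
    then have "s * u = (s * a) * l + (s * b) * [:p:]" by (simp only: algebra_simps)
    then show "s * u \<in> I" unfolding I_def by blast
  qed
  moreover have "1 \<notin> I"
  proof
    \<comment> \<open>Multiplying the representation of 1 by \<kappa> expresses \<kappa> as the
      value of an integer polynomial \<open>g\<close>, which can be reduced below the degree of
      \<open>f\<close>. Then \<open>k = [:p:] * g\<close>, although \<open>k\<close> is
      monic.\<close>
    assume "1 \<in> I"
    then obtain a b where ab: "1 = a * l + b * [:p:]" by (auto simp: I_def)
    have "1 = int_eval \<theta> a * int_eval \<theta> l + int_eval \<theta> b * of_int p"
      using arg_cong[OF ab, of "int_eval \<theta>"] by (simp del: mult_pCons_right)
    then have "\<kappa> = int_eval \<theta> a * (\<kappa> * int_eval \<theta> l) + int_eval \<theta> b * (of_int p * \<kappa>)"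
      by (metis (no_types, lifting) distrib_right mult.assoc mult.commute mult_1)
    also have "\<dots> = int_eval \<theta> (b * k - a * t)"
      using ev_t ev_k by simp
    finally obtain g where g: "degree g < degree f" "int_eval \<theta> g = \<kappa>"
      using int_eval_reduce by metis
    have "degree (k - [:p:] * g) < degree f"
      using deg_k g(1) degree_smult_le[of p g] by (simp add: degree_diff_less)
    moreover have "int_eval \<theta> (k - [:p:] * g) = 0"
      using g(2) ev_k by simp
    ultimately have "k - [:p:] * g = 0" using int_eval_eq_0_iff_small by blast
    then have "k = [:p:] * g" by simp
    then have "p dvd lead_coeff k" by simp
    then show False using k(2) p by (simp add: not_prime_unit)
  qed
  ultimately obtain P where P: "prime_ring_ideal P" "I \<subseteq> P"
    by (rule prime_ring_ideal_exists)
  have idl: "ring_ideal P" using P(1) by (simp add: prime_ring_ideal_def)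
  have "l \<in> I" unfolding I_def by (intro CollectI exI[of _ 1] exI[of _ 0]) simp
  moreover have "[:p:] \<in> I" unfolding I_def by (intro CollectI exI[of _ 0] exI[of _ 1]) simp
  ultimately have lP: "l \<in> P" and pP: "[:p:] \<in> P" using P(2) by auto
  have fP: "f \<in> P"
    unfolding lr(1) t using idl lP pP
    by (intro ring_ideal_add ring_ideal_mult_left ring_ideal_mult_right)
  \<comment> \<open>Membership in \<open>P\<close> passes to integral multiples: a power of
    \<open>w\<close> lies in \<open>P\<close>, which is prime. It is applied to the multiples of
    \<open>p\<close> and \<open>l\<close> by \<kappa> and \<open>- \<kappa>\<close>.\<close>
  have in_P: "w \<in> P" if z: "algebraic_int z" and wv: "int_eval \<theta> w = z * int_eval \<theta> v" and "v \<in> P" for w v z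
  proof -
    obtain N q where "f dvd w ^ N - v * q" using algebraic_int_quotient_dvd[OF z wv] by blast
    then obtain s where "w ^ N - v * q = f * s" by (elim dvdE)
    then have "w ^ N = f * s + v * q" by (simp add: diff_eq_eq)
    then have "w ^ N \<in> P"
      using idl fP \<open>v \<in> P\<close> by (simp add: ring_ideal_add ring_ideal_mult_right)
    then show ?thesis using P(1) prime_ring_ideal_power by blast
  qed
  have "k \<in> P" using in_P[OF \<kappa>, of k "[:p:]"] ev_k pP by (simp add: mult.commute)
  moreover have "t \<in> P" using in_P[of "- \<kappa>" t l] \<kappa> ev_t lP by simp
  ultimately show thesis using that P(1) pP lP lr(1) t by blast
qed

end

section \<open>The field generated by a root and its power basis\<close>

lemma int_eval_in_rat_adjoin: "int_eval \<theta> w \<in> rat_adjoin \<theta>"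
  unfolding rat_adjoin_def hull_def
proof (intro InterI, clarify)
  fix K assume K: "insert \<theta> \<rat> \<subseteq> K" "complex_subfield K"
  show "int_eval \<theta> w \<in> K"
  proof (induction w)
    case 0
    show ?case using K(2) by (simp add: complex_subfield_def)
  next
    case (pCons c w)
    have "of_int c \<in> K" "\<theta> \<in> K" using K(1) by auto
    then show ?case using pCons.IH K(2) by (simp add: complex_subfield_def)
  qed
qed

context monic_irreducible_root
begin

text \<open>A non-zero value at \<theta> means that \<open>w\<close> is coprime to \<open>f\<close>
  over the rationals; evaluating the Bezout identity at \<theta> removes the term with
  \<open>f\<close>.\<close>

lemma int_eval_inverse:
  assumes "int_eval \<theta> w \<noteq> 0"
  obtains v d where "d \<noteq> 0" and "inverse (int_eval \<theta> w) = int_eval \<theta> v / of_int d"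
proof -
  have "\<not> map_poly rat_of_int f dvd map_poly rat_of_int w"
  proof
    assume "map_poly rat_of_int f dvd map_poly rat_of_int w"
    then obtain Q where Q: "map_poly rat_of_int w = map_poly rat_of_int f * Q" by (elim dvdE)
    obtain d q where d: "d \<noteq> 0" and q: "smult (of_int d) Q = map_poly rat_of_int q"
      by (rule int_poly_clear_denominators)
    have "map_poly rat_of_int (smult d w) = map_poly rat_of_int (f * q)"
      by (simp add: hom_distribs Q q[symmetric])
    then have "smult d w = f * q" by simp
    then have "int_eval \<theta> (smult d w) = 0" using root by simp
    then show False using assms d by simp
  qed
  then obtain u v d where d: "d \<noteq> 0" and uv: "u * f + v * w = [:d:]"
    using int_poly_bezout[OF irreducible] by blast
  have "int_eval \<theta> v * int_eval \<theta> w = of_int d"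
    using arg_cong[OF uv, of "int_eval \<theta>"] root by simp
  then have "inverse (int_eval \<theta> w) = int_eval \<theta> v / of_int d"
    using assms d by (simp add: field_simps)
  then show thesis using that d by blast
qed

text \<open>Fractions with an integer denominator already form a subfield containing \<theta>, so
  minimality of the hull applies.\<close>

lemma rat_adjoin_fraction:
  assumes "z \<in> rat_adjoin \<theta>"
  obtains g d where "d \<noteq> 0" and "z = int_eval \<theta> g / of_int d"
proof -
  define K where "K = {int_eval \<theta> g / of_int d | g d. d \<noteq> 0}"
  have K_I: "int_eval \<theta> g / of_int d \<in> K" if "d \<noteq> 0" for g d
    using that by (auto simp: K_def)
  have "complex_subfield K"
    unfolding complex_subfield_def
  proof (intro conjI ballI)
    show "0 \<in> K" using K_I[of 1 0] by simp
    show "1 \<in> K" using K_I[of 1 1] by simp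
  next
    fix x y assume "x \<in> K" "y \<in> K"
    then obtain g c h d where xy: "x = int_eval \<theta> g / of_int c" "c \<noteq> 0"
      "y = int_eval \<theta> h / of_int d" "d \<noteq> 0" by (auto simp: K_def)
    have "x + y = int_eval \<theta> (smult d g + smult c h) / of_int (c * d)"
      using xy by (simp add: add_frac_eq mult.commute)
    then show "x + y \<in> K"
      using K_I[of "c * d" "smult d g + smult c h"] xy by simp
    show "x * y \<in> K"
      using K_I[of "c * d" "g * h"] xy by simp
  next
    fix x assume "x \<in> K"
    then obtain g c where x: "x = int_eval \<theta> g / of_int c" "c \<noteq> 0" by (auto simp: K_def)
    show "- x \<in> K" using K_I[of c "- g"] x by simp
    show "inverse x \<in> K"
    proof (cases "int_eval \<theta> g = 0")
      case True
      then show ?thesis using x K_I[of 1 0] by simp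
    next
      case False
      then obtain v d where vd: "d \<noteq> 0" "inverse (int_eval \<theta> g) = int_eval \<theta> v / of_int d"
        by (rule int_eval_inverse)
      have "inverse x = of_int c * inverse (int_eval \<theta> g)"
        using x by (simp add: divide_inverse)
      then show ?thesis using vd K_I[of d "smult c v"] by simp
    qed
  qed
  moreover have "insert \<theta> \<rat> \<subseteq> K"
  proof -
    have "\<theta> \<in> K" using K_I[of 1 "[:0, 1:]"] by simp
    moreover have "x \<in> K" if x: "x \<in> \<rat>" for x
    proof -
      obtain a b where "b > 0" "x = of_int a / of_int b" using x by (rule Rats_cases')
      then show ?thesis using K_I[of b "[:a:]"] by simp
    qed
    ultimately show ?thesis by auto
  qed
  ultimately have "rat_adjoin \<theta> \<subseteq> K"
    unfolding rat_adjoin_def by (intro hull_minimal)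
  then show thesis using assms that by (auto simp: K_def)
qed

text \<open>Reduction modulo the monic \<open>f\<close> leaves only powers below its degree.\<close>

lemma span_powers: "int_module.span ((^) \<theta> ` {..<degree f}) = range (int_eval \<theta>)"
proof (intro equalityI subsetI)
  fix z assume "z \<in> int_module.span ((^) \<theta> ` {..<degree f})"
  then show "z \<in> range (int_eval \<theta>)"
  proof (induction rule: int_module.span_induct_alt)
    case base
    show ?case by (rule image_eqI[of _ _ 0]) simp_all
  next
    case (step c x y)
    then obtain i w where iw: "x = \<theta> ^ i" "y = int_eval \<theta> w" by auto
    show ?case by (rule image_eqI[of _ _ "monom c i + w"]) (simp_all add: iw)
  qed
next
  fix z assume "z \<in> range (int_eval \<theta>)"
  then obtain w where "z = int_eval \<theta> w" by auto
  then obtain r where r: "degree r < degree f" "z = int_eval \<theta> r"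
    using int_eval_reduce by metis
  show "z \<in> int_module.span ((^) \<theta> ` {..<degree f})"
    unfolding r(2) int_eval_altdef using r(1)
    by (intro int_module.span_sum int_module.span_scale int_module.span_base) auto
qed

lemma coeffs_unique:
  assumes "(\<Sum>i<degree f. of_int (c i) * \<theta> ^ i) = 0" and "i < degree f"
  shows "c i = 0"
proof -
  define w where "w = (\<Sum>i<degree f. monom (c i) i)"
  have coeff: "coeff w j = (if j < degree f then c j else 0)" for j
    by (simp add: w_def coeff_sum sum.delta)
  have "degree w < degree f"
    using degree_pos by (intro degree_lessI) (auto simp: coeff)
  moreover have "int_eval \<theta> w = 0" using assms(1) by (simp add: w_def)
  ultimately have "w = 0" using int_eval_eq_0_iff_small by blast
  then show ?thesis using coeff[of i] assms(2) by simp
qed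

lemma inj_on_powers: "inj_on ((^) \<theta>) {..<degree f}"
proof (rule inj_onI)
  fix i j assume ij: "i \<in> {..<degree f}" "j \<in> {..<degree f}" "\<theta> ^ i = \<theta> ^ j"
  define w :: "int poly" where "w = monom 1 i - monom 1 j"
  have "degree w < degree f"
    using ij unfolding w_def by (intro degree_diff_less) (auto simp: degree_monom_eq)
  moreover have "int_eval \<theta> w = 0" using ij(3) by (simp add: w_def)
  ultimately have "w = 0" using int_eval_eq_0_iff_small by blast
  then show "i = j" by (simp add: w_def monom_eq_iff')
qed

lemma independent_powers: "int_module.independent ((^) \<theta> ` {..<degree f})"
proof -
  have "u v = 0" if "(\<Sum>x\<in>(^) \<theta> ` {..<degree f}. of_int (u x) * x) = 0" "v \<in> (^) \<theta> ` {..<degree f}"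
    for u :: "complex \<Rightarrow> int" and v
  proof -
    have "(\<Sum>i<degree f. of_int (u (\<theta> ^ i)) * \<theta> ^ i) = 0"
      using that(1) by (simp add: sum.reindex[OF inj_on_powers])
    then show ?thesis using coeffs_unique[of "\<lambda>i. u (\<theta> ^ i)"] that(2) by auto
  qed
  then show ?thesis
    by (subst int_module.dependent_finite) auto
qed

end

text \<open>An integral element of the field is a polynomial value over an integer \<open>d\<close>.
  The last premise forbids the outcome of Dedekind's criterion, so each prime factor of
  \<open>d\<close> cancels against the numerator; descent on the absolute value of \<open>d\<close>
  removes the denominator.\<close>

lemma monogenicI:
  fixes f :: "int poly"
  assumes "lead_coeff f = 1" and "irreducible (map_poly rat_of_int f)"
    and regular: "\<And>p P k l t. prime p \<Longrightarrow> prime_ring_ideal P \<Longrightarrow> [:p:] \<in> P \<Longrightarrow>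
      k \<in> P \<Longrightarrow> l \<in> P \<Longrightarrow> t \<in> P \<Longrightarrow> f = k * l + [:p:] * t \<Longrightarrow> False"
  shows "monogenic f"
proof -
  have "int_basis ((^) \<theta>) {..<degree f} (ring_of_integers (rat_adjoin \<theta>))"
    if "int_eval \<theta> f = 0" for \<theta>
  proof -
    interpret monic_irreducible_root f \<theta>
      using assms that by unfold_locales
    have descent: "int_eval \<theta> g / of_int d \<in> range (int_eval \<theta>)"
      if "algebraic_int (int_eval \<theta> g / of_int d)" "d \<noteq> 0" for g d
      using that
    proof (induction "nat \<bar>d\<bar>" arbitrary: g d rule: less_induct)
      case less
      show ?case
      proof (cases "is_unit d")
        case True
        then have "d = 1 \<or> d = - 1" by auto
        then have "int_eval \<theta> g / of_int d = int_eval \<theta> (smult d g)" by auto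
        then show ?thesis by blast
      next
        case False
        then obtain p where "prime p" "p dvd d"
          using prime_divisor_exists less.prems(2) by blast
        then obtain e where e: "d = p * e" by (elim dvdE)
        \<comment> \<open>The criterion speaks about the coefficients of the representative of
          degree below that of \<open>f\<close>.\<close>
        obtain r where r: "degree r < degree f" "int_eval \<theta> r = int_eval \<theta> g"
          by (rule int_eval_reduce)
        \<comment> \<open>Multiplication by the cofactor \<open>e\<close> keeps integrality and
          leaves the prime denominator \<open>p\<close>.\<close>
        have "of_int e * (int_eval \<theta> g / of_int d) = int_eval \<theta> r / of_int p"
          using less.prems(2) e r(2) by simp
        then have "algebraic_int (int_eval \<theta> r / of_int p)"
          using algebraic_int_mult[OF algebraic_int_of_int less.prems(1)] by metis
        then have "[:p:] dvd r"
          using dedekind_criterion[OF \<open>prime p\<close> _ r(1)] regular[OF \<open>prime p\<close>] by metis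
        then obtain s where "r = [:p:] * s" by (elim dvdE)
        then have eq: "int_eval \<theta> g / of_int d = int_eval \<theta> s / of_int e"
          using less.prems(2) e r(2)[symmetric] by simp
        moreover have "e \<noteq> 0" "nat \<bar>e\<bar> < nat \<bar>d\<bar>"
          using less.prems(2) e prime_gt_1_int[OF \<open>prime p\<close>] by (auto simp: abs_mult)
        ultimately show ?thesis
          using less.hyps[of e s] less.prems(1) by simp
      qed
    qed
    have "ring_of_integers (rat_adjoin \<theta>) = range (int_eval \<theta>)"
    proof (intro equalityI subsetI)
      fix z assume "z \<in> ring_of_integers (rat_adjoin \<theta>)"
      then have "algebraic_int z" "z \<in> rat_adjoin \<theta>" by (auto simp: ring_of_integers_def)
      then show "z \<in> range (int_eval \<theta>)" using descent rat_adjoin_fraction by metis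
    next
      fix z assume "z \<in> range (int_eval \<theta>)"
      then show "z \<in> ring_of_integers (rat_adjoin \<theta>)"
        using int_eval_in_rat_adjoin algebraic_int_int_eval[OF algebraic_int_root]
        by (auto simp: ring_of_integers_def)
    qed
    then show ?thesis
      using inj_on_powers independent_powers span_powers by (simp add: int_basis_def)
  qed
  then show ?thesis
    using assms(1,2) by (simp add: monogenic_def int_eval_def)
qed

section \<open>Irreducibility\<close>

text \<open>Take the least \<open>i\<close> for which \<open>p\<close> does not divide
  \<open>coeff g i\<close>; modulo \<open>p\<close> only \<open>coeff g i * coeff h 0\<close>
  survives in the coefficient of the product.\<close>

lemma not_all_coeffs_dvd_mult:
  fixes g h :: "'a::{comm_ring_1,normalization_semidom} poly"
  assumes p: "prime p" and "\<not> p dvd lead_coeff g" and "\<not> p dvd coeff h 0"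
  obtains i where "i \<le> degree g" and "\<not> p dvd coeff (g * h) i"
proof -
  define i where "i = (LEAST i. \<not> p dvd coeff g i)"
  have i: "\<not> p dvd coeff g i" "i \<le> degree g"
    using assms(2) LeastI[of "\<lambda>i. \<not> p dvd coeff g i"] Least_le[of "\<lambda>i. \<not> p dvd coeff g i"]
    unfolding i_def by blast+
  have "p dvd coeff g j" if "j < i" for j
    using not_less_Least[of j] that unfolding i_def by blast
  then have "p dvd (\<Sum>j<i. coeff g j * coeff h (i - j))"
    by (intro dvd_sum) simp
  moreover have "coeff (g * h) i = (\<Sum>j<i. coeff g j * coeff h (i - j)) + coeff g i * coeff h 0"
    by (simp add: coeff_mult flip: lessThan_Suc_atMost)
  moreover have "\<not> p dvd coeff g i * coeff h 0"
    using p i(1) assms(3) by (simp add: prime_dvd_mult_iff)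
  ultimately have "\<not> p dvd coeff (g * h) i"
    by (simp add: dvd_add_right_iff)
  then show thesis using that i(2) by blast
qed

text \<open>As \<open>p ^ 2\<close> does not divide the constant term, one factor has constant term
  prime to \<open>p\<close>. Then the degree of the other factor is at least that of
  \<open>f\<close>, and the first is a constant with unit leading coefficient.\<close>

lemma eisenstein_criterion:
  fixes f :: "int poly"
  assumes p: "prime p" and monic: "lead_coeff f = 1" and pos: "degree f > 0"
    and low: "\<And>i. i < degree f \<Longrightarrow> p dvd coeff f i" and const: "\<not> p ^ 2 dvd coeff f 0"
  shows "irreducible f"
proof (rule irreducibleI)
  show "f \<noteq> 0" "\<not> is_unit f" using pos by (auto simp: is_unit_poly_iff)
  fix g h assume f: "f = g * h"
  have nz: "g \<noteq> 0" "h \<noteq> 0" using f pos by auto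
  have lead: "lead_coeff g * lead_coeff h = 1" using monic f by (simp add: lead_coeff_mult)
  then have units: "is_unit (lead_coeff g)" "is_unit (lead_coeff h)"
    by (metis dvd_triv_left, metis dvd_triv_right)
  have unit: "is_unit w" if "degree w = 0" "is_unit (lead_coeff w)" for w :: "int poly"
    using that by (elim degree_eq_zeroE) (simp add: is_unit_pCons_iff)
  have nlead: "\<not> p dvd lead_coeff g" "\<not> p dvd lead_coeff h"
    using units p by (meson dvd_trans not_prime_unit)+
  have deg: "degree f = degree g + degree h" using f nz by (simp add: degree_mult_eq)
  have "degree h = 0" if h0: "\<not> p dvd coeff h 0"
  proof -
    obtain i where "i \<le> degree g" "\<not> p dvd coeff f i"
      using not_all_coeffs_dvd_mult[OF p nlead(1) h0] unfolding f by blast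
    then show ?thesis using low[of i] deg by fastforce
  qed
  moreover have "degree g = 0" if g0: "\<not> p dvd coeff g 0"
  proof -
    obtain i where "i \<le> degree h" "\<not> p dvd coeff f i"
      using not_all_coeffs_dvd_mult[OF p nlead(2) g0] unfolding f mult.commute[of g] by blast
    then show ?thesis using low[of i] deg by fastforce
  qed
  moreover have "\<not> (p dvd coeff g 0 \<and> p dvd coeff h 0)"
    using const by (auto simp: f coeff_mult power2_eq_square intro: mult_dvd_mono)
  ultimately show "is_unit g \<or> is_unit h" using unit units by blast
qed

section \<open>The polynomial and its prime ideals\<close>

lemma F_poly_altdef:
  "F_poly n b m = monom 1 n + smult b (\<Sum>i<n. monom (m ^ 2) 1 ^ i)"
proof -
  have "(\<Sum>j=1..n. monom (m ^ 2) 1 ^ (n - j)) = (\<Sum>i<n. monom (m ^ 2) 1 ^ i)"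
    by (rule sum.reindex_bij_witness[of _ "\<lambda>i. n - i" "\<lambda>j. n - j"]) auto
  then show ?thesis by (simp add: F_poly_def)
qed

lemma coeff_F_poly:
  "coeff (F_poly n b m) i = (if i = n then 1 else if i < n then b * m ^ (2 * i) else 0)"
  by (simp add: F_poly_altdef coeff_sum monom_power sum.delta power_mult)

lemma degree_F_poly: "degree (F_poly n b m) = n"
  by (intro antisym degree_le le_degree) (auto simp: coeff_F_poly)

text \<open>Eisenstein applies at \<open>p\<close>: the coefficients below the leading one are
  multiples of \<open>b\<close>, and the constant one is \<open>b\<close> itself.\<close>

lemma irreducible_F_poly:
  assumes "n > 0" and p: "prime p" and "p dvd b" and "squarefree b"
  shows "irreducible (F_poly n b m)"
  using p
proof (rule eisenstein_criterion)
  have "\<not> p ^ 2 dvd b"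
    using p \<open>squarefree b\<close> squarefreeD not_prime_unit by blast
  then show "\<not> p ^ 2 dvd coeff (F_poly n b m) 0"
    using \<open>n > 0\<close> by (simp add: coeff_F_poly)
qed (use assms in \<open>auto simp: coeff_F_poly degree_F_poly\<close>)

text \<open>The factor \<open>m ^ 2 * x - 1\<close> telescopes the geometric sum.\<close>

lemma F_poly_trinomial:
  "[:- 1, m ^ 2:] * F_poly n b m = monom (m ^ 2) (n + 1) - monom (1 - b * m ^ (2 * n)) n - [:b:]"
proof -
  let ?X = "monom (m ^ 2) 1"
  have "[:- 1, m ^ 2:] = ?X - 1"
    by (simp add: monom_altdef one_pCons)
  then have "[:- 1, m ^ 2:] * F_poly n b m = (?X - 1) * monom 1 n + smult b ((?X - 1) * (\<Sum>i<n. ?X ^ i))"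
    by (simp add: F_poly_altdef distrib_left)
  also have "(?X - 1) * (\<Sum>i<n. ?X ^ i) = monom (m ^ (2 * n)) n - 1"
    by (simp only: power_diff_1_eq[symmetric]) (simp add: monom_power power_mult)
  also have "(?X - 1) * monom 1 n + smult b (monom (m ^ (2 * n)) n - 1)
      = monom (m ^ 2) (n + 1) - monom (1 - b * m ^ (2 * n)) n - [:b:]"
    by (simp add: left_diff_distrib mult_monom smult_diff_right smult_monom diff_monom[symmetric] one_pCons)
  finally show ?thesis .
qed

text \<open>The product rule applied to the trinomial identity. An ideal containing \<open>f\<close>
  and its derivative thus contains a power of \<open>x\<close> times a linear polynomial.\<close>

lemma pderiv_F_poly_trinomial:
  assumes "n > 0"
  shows "smult (m ^ 2) (F_poly n b m) + [:- 1, m ^ 2:] * pderiv (F_poly n b m)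
    = monom 1 (n - 1) * [:- (int n * (1 - b * m ^ (2 * n))), (int n + 1) * m ^ 2:]"
proof -
  obtain k where n: "n = Suc k" using assms gr0_implies_Suc by blast
  have "smult (m ^ 2) (F_poly n b m) + [:- 1, m ^ 2:] * pderiv (F_poly n b m)
      = pderiv ([:- 1, m ^ 2:] * F_poly n b m)"
    by (simp only: pderiv_mult) (simp add: pderiv_pCons mult.commute)
  also have "\<dots> = monom ((int n + 1) * m ^ 2) (Suc k) - monom (int n * (1 - b * m ^ (2 * n))) k"
    unfolding F_poly_trinomial by (simp add: n pderiv_diff pderiv_monom pderiv_pCons add.commute)
  also have "\<dots> = monom 1 (n - 1) * [:- (int n * (1 - b * m ^ (2 * n))), (int n + 1) * m ^ 2:]"
    by (simp add: n poly_eq_iff coeff_monom_mult coeff_pCons split: nat.split)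
  finally show ?thesis .
qed

section \<open>Square factors of the discriminant quantity\<close>

text \<open>Past its linear term, the binomial expansion is \<open>u ^ 2\<close> times a form of
  degree \<open>k\<close> in \<open>x\<close> and \<open>u\<close>, and \<open>p\<close> divides
  both variables.\<close>

lemma power_diff_quotient_dvd:
  fixes x u p :: int
  assumes "p dvd x" and "p dvd u"
  obtains E where "(x - u) ^ (k + 2) - x ^ (k + 2) + of_nat (k + 2) * x ^ (k + 1) * u = u ^ 2 * E"
    and "p ^ k dvd E"
proof -
  have "\<exists>E. (x - u) ^ (k + 2) - x ^ (k + 2) + of_nat (k + 2) * x ^ (k + 1) * u = u ^ 2 * E \<and> p ^ k dvd E"
  proof (induction k)
    case 0
    show ?case by (intro exI[of _ 1]) (simp add: algebra_simps power2_eq_square)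
  next
    case (Suc k)
    then obtain E where E: "(x - u) ^ (k + 2) - x ^ (k + 2) + of_nat (k + 2) * x ^ (k + 1) * u = u ^ 2 * E"
      "p ^ k dvd E" by blast
    define E' where "E' = (x - u) * E + of_nat (k + 2) * x ^ (k + 1)"
    have "(x - u) ^ (Suc k + 2) - x ^ (Suc k + 2) + of_nat (Suc k + 2) * x ^ (Suc k + 1) * u
        = (x - u) * ((x - u) ^ (k + 2) - x ^ (k + 2) + of_nat (k + 2) * x ^ (k + 1) * u)
          + u ^ 2 * (of_nat (k + 2) * x ^ (k + 1))"
      by (simp add: algebra_simps power2_eq_square)
    also have "\<dots> = u ^ 2 * E'"
      unfolding E(1) E'_def by (simp add: algebra_simps)
    finally have 1: "(x - u) ^ (Suc k + 2) - x ^ (Suc k + 2) + of_nat (Suc k + 2) * x ^ (Suc k + 1) * u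
        = u ^ 2 * E'" .
    have "p ^ Suc k dvd (x - u) * E"
      using assms E(2) by (simp add: mult_dvd_mono)
    moreover have "p ^ Suc k dvd x ^ (k + 1)"
      using assms(1) dvd_power_same[of p x "Suc k"] by simp
    ultimately have "p ^ Suc k dvd E'"
      unfolding E'_def by simp
    with 1 show ?case by blast
  qed
  then show thesis using that by blast
qed

lemma D_val_eq:
  assumes "1 + b * m ^ (2 * n) * int n \<noteq> 0"
  shows "int n ^ n * (1 - b * m ^ (2 * n)) ^ (n + 1) + b * m ^ (2 * n) * (int n + 1) ^ (n + 1)
    = (1 + b * m ^ (2 * n) * int n) ^ 2 * D_val n b m"
  unfolding D_val_def using D_val_dvd[of "b * m ^ (2 * n)" n] by (simp add: mult.assoc)

text \<open>Expand around \<open>x = n + 1\<close> with \<open>u = 1 + c * n\<close>, both divisible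
  by \<open>p\<close>. Since \<open>x - u = n * (1 - c)\<close>, the quotient \<open>E\<close>
  equals \<open>n * D_val n b m\<close>, and \<open>p\<close> does not divide
  \<open>n\<close>.\<close>

lemma square_dvd_D_val:
  assumes n: "n \<ge> 3" and p: "prime p" and "p dvd int n + 1" and "p dvd 1 - b * m ^ (2 * n)"
    and u0: "1 + b * m ^ (2 * n) * int n \<noteq> 0"
  shows "p ^ 2 dvd D_val n b m"
proof -
  define c where "c = b * m ^ (2 * n)"
  define u where "u = 1 + c * int n"
  have pN: "p dvd int n + 1" and pc: "p dvd 1 - c" using assms by (simp_all add: c_def)
  have "u = (int n + 1) - int n * (1 - c)" by (simp add: u_def algebra_simps)
  then have pu: "p dvd u" using pN pc by simp
  obtain k where k: "n = k + 1" using n by (metis Suc_eq_plus1 Suc_le_D numeral_3_eq_3)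
  obtain E where E: "(int n + 1 - u) ^ (k + 2) - (int n + 1) ^ (k + 2)
      + of_nat (k + 2) * (int n + 1) ^ (k + 1) * u = u ^ 2 * E" and "p ^ k dvd E"
    using power_diff_quotient_dvd[OF pN pu, of k] by blast
  have "u ^ 2 * E = (int n * (1 - c)) ^ (n + 1) - (int n + 1) ^ (n + 1) + (int n + 1) * (int n + 1) ^ n * u"
    unfolding E[symmetric] by (simp add: k u_def algebra_simps)
  also have "\<dots> = int n * (int n ^ n * (1 - c) ^ (n + 1) + c * (int n + 1) ^ (n + 1))"
    by (simp add: u_def power_mult_distrib) (simp add: algebra_simps)
  also have "\<dots> = u ^ 2 * (int n * D_val n b m)"
    using D_val_eq[OF u0] by (simp add: u_def c_def)
  finally have "E = int n * D_val n b m"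
    using u0 by (simp add: u_def c_def)
  \<comment> \<open>The exponent is \<open>k = n - 1\<close>, at least 2 because
    \<open>n \<ge> 3\<close>.\<close>
  moreover have "p ^ 2 dvd p ^ k" using n k by (intro le_imp_power_dvd) simp
  ultimately have "p ^ 2 dvd int n * D_val n b m" using \<open>p ^ k dvd E\<close> dvd_trans by blast
  moreover have "coprime (p ^ 2) (int n)"
  proof -
    have "\<not> p dvd int n"
      using p pN by (metis dvd_add_right_iff not_prime_unit)
    then show ?thesis using p by (simp add: prime_imp_coprime)
  qed
  ultimately show ?thesis by (simp add: coprime_dvd_mult_right_iff)
qed

text \<open>Only powers of primes dividing \<open>b * m\<close> are removed from
  \<open>D_val\<close>, and these are coprime to \<open>p\<close>.\<close>

lemma square_dvd_d_val:
  assumes "b * m \<noteq> 0" and p: "prime p" and ndvd: "\<not> p dvd b * m" and "p ^ 2 dvd D_val n b m"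
  shows "p ^ 2 dvd d_val n b m"
proof -
  let ?S = "{q. prime q \<and> q dvd b * m}"
  let ?Q = "\<Prod>q\<in>?S. q ^ multiplicity q (D_val n b m)"
  have "\<bar>D_val n b m\<bar> = d_val n b m * ?Q"
    unfolding d_val_def using d_val_dvd[OF assms(1)] by simp
  then have "p ^ 2 dvd d_val n b m * ?Q" using assms(4) by (metis dvd_abs_iff)
  moreover have "coprime (p ^ 2) ?Q"
  proof (rule prod_coprime_right)
    fix q assume "q \<in> ?S"
    then have "coprime p q" using p ndvd by (auto intro: primes_coprime)
    then show "coprime (p ^ 2) (q ^ multiplicity q (D_val n b m))" by simp
  qed
  ultimately show ?thesis by (simp add: coprime_dvd_mult_left_iff)
qed

section \<open>Prime ideals above \<open>p\<close> and regularity of the polynomial\<close>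

text \<open>Otherwise a Bezout combination of \<open>p\<close> and \<open>c\<close> would put 1 into
  \<open>P\<close>.\<close>

lemma prime_ideal_const_dvd:
  fixes p c :: int
  assumes "prime p" and P: "prime_ring_ideal P" and "[:p:] \<in> P" and "[:c:] \<in> P"
  shows "p dvd c"
proof (rule ccontr)
  assume "\<not> p dvd c"
  then have "coprime p c" using \<open>prime p\<close> by (simp add: prime_imp_coprime)
  then obtain s t where st: "s * p + t * c = 1" by (metis bezout_int coprime_imp_gcd_eq_1)
  have idl: "ring_ideal P" using P by (simp add: prime_ring_ideal_def)
  have "[:s:] * [:p:] + [:t:] * [:c:] \<in> P"
    using assms idl by (intro ring_ideal_add ring_ideal_mult_left)
  also have "[:s:] * [:p:] + [:t:] * [:c:] = 1" using st by (simp add: one_pCons mult.commute)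
  finally show False using P by (simp add: prime_ring_ideal_def)
qed

text \<open>Modulo \<open>x - r\<close> the polynomial \<open>w\<close> is the constant
  \<open>poly w r\<close>, which therefore lies in \<open>P\<close>.\<close>

lemma prime_ideal_poly_dvd:
  fixes p r :: int
  assumes "prime p" and P: "prime_ring_ideal P" and "[:p:] \<in> P" and r: "[:- r, 1:] \<in> P" and w: "w \<in> P"
  shows "p dvd poly w r"
proof -
  have idl: "ring_ideal P" using P by (simp add: prime_ring_ideal_def)
  have "[:poly w r:] = w - [:- r, 1:] * synthetic_div w r"
    using synthetic_div_correct'[of r w] by (metis add_diff_cancel_left')
  also have "\<dots> \<in> P" using idl r w by (intro ring_ideal_diff ring_ideal_mult_right)
  finally show ?thesis using assms prime_ideal_const_dvd by blast
qed

text \<open>This provides the last premise of \<open>monogenicI\<close> for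
  \<open>F_poly\<close>.\<close>

lemma F_poly_regular:
  fixes n :: nat and m b p :: int
  assumes n: "n \<ge> 3" and b: "b \<ge> 2" and m: "m \<noteq> 0" and "squarefree b"
    and d: "squarefree (d_val n b m)" and nm: "coprime (int n) m"
    and p: "prime p" and P: "prime_ring_ideal P" and pP: "[:p:] \<in> P"
    and k: "k \<in> P" and l: "l \<in> P" and t: "t \<in> P" and F: "F_poly n b m = k * l + [:p:] * t"
  shows False
proof -
  define f where "f = F_poly n b m"
  define c where "c = b * m ^ (2 * n)"
  have nonunit: "\<not> p ^ 2 dvd x" if "squarefree x" for x
    using that p squarefreeD not_prime_unit by blast
  have idl: "ring_ideal P" using P by (simp add: prime_ring_ideal_def)
  note idl_intros = ring_ideal_add[OF idl] ring_ideal_diff[OF idl]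
    ring_ideal_mult_left[OF idl] ring_ideal_mult_right[OF idl]
  have const: "p dvd x" if "[:x:] \<in> P" for x
    using prime_ideal_const_dvd[OF p P pP that] .
  have constI: "[:x:] \<in> P" if dvd: "p dvd x" for x
  proof -
    obtain e where "x = p * e" using dvd by (elim dvdE)
    then have "[:x:] = [:p:] * [:e:]" by simp
    then show ?thesis using pP idl_intros by metis
  qed
  \<comment> \<open>At such an \<open>r\<close>, the values of \<open>k\<close>, \<open>l\<close>
    and \<open>t\<close> are all divisible by \<open>p\<close>, so \<open>k * l + [:p:] * t\<close>
    gains a factor \<open>p ^ 2\<close>.\<close>
  have at_root: "p ^ 2 dvd poly f r" if r: "[:- r, 1:] \<in> P" for r
  proof -
    have "p dvd poly w r" if "w \<in> P" for w
      using prime_ideal_poly_dvd[OF p P pP r that] .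
    then have "p * p dvd poly k r * poly l r + p * poly t r"
      using k l t by (intro dvd_add mult_dvd_mono) auto
    then show ?thesis by (simp add: f_def F power2_eq_square)
  qed
  have fP: "f \<in> P" unfolding f_def F using pP k l t by (intro idl_intros)
  have f'P: "pderiv f \<in> P"
  proof -
    have "pderiv f = k * pderiv l + l * pderiv k + [:p:] * pderiv t"
      by (simp add: f_def F pderiv_add pderiv_mult pderiv_smult)
    then show ?thesis using pP k l t idl_intros by metis
  qed
  have npb: "\<not> p dvd b"
  proof
    assume "p dvd b"
    then have "[:b:] * (\<Sum>i<n. monom (m ^ 2) 1 ^ i) \<in> P" by (intro idl_intros constI)
    moreover have "[:0, 1:] ^ n = f - [:b:] * (\<Sum>i<n. monom (m ^ 2) 1 ^ i)"
      by (simp add: f_def F_poly_altdef monom_altdef)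
    ultimately have "[:0, 1:] ^ n \<in> P" using fP by (metis ring_ideal_diff[OF idl])
    then have "[:0, 1:] \<in> P" by (rule prime_ring_ideal_power[OF P])
    then have "p ^ 2 dvd poly f 0" using at_root[of 0] by simp
    then show False
      using nonunit[OF \<open>squarefree b\<close>] n by (simp add: f_def poly_0_coeff_0 coeff_F_poly)
  qed
  have xP: "[:0, 1:] \<notin> P"
  proof
    assume x: "[:0, 1:] \<in> P"
    \<comment> \<open>Solving the trinomial identity for its constant shows that \<open>x\<close> in
      \<open>P\<close> would force \<open>b\<close> into \<open>P\<close>.\<close>
    have "[:b:] = [:0, 1:] ^ n * ([:0, m ^ 2:] - [:1 - c:]) - [:- 1, m ^ 2:] * f"
      unfolding f_def F_poly_trinomial
      by (simp add: c_def monom_altdef algebra_simps smult_diff_left)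
    moreover have "[:0, 1:] ^ n \<in> P" using ring_ideal_mult_right[OF idl x] n by (metis power_eq_if not_numeral_le_zero)
    ultimately have "[:b:] \<in> P" using fP idl_intros by metis
    then show False using npb const by blast
  qed
  define L where "L = [:- (int n * (1 - c)), (int n + 1) * m ^ 2:]"
  have deriv: "smult (m ^ 2) f + [:- 1, m ^ 2:] * pderiv f = monom 1 (n - 1) * L"
    unfolding f_def L_def c_def by (rule pderiv_F_poly_trinomial) (use n in simp)
  have LP: "L \<in> P"
  proof -
    have "[:0, 1:] ^ (n - 1) * L = [:m ^ 2:] * f + [:- 1, m ^ 2:] * pderiv f"
      using deriv by (simp add: monom_altdef)
    then have "[:0, 1:] ^ (n - 1) * L \<in> P" using fP f'P idl_intros by metis
    then show ?thesis using xP prime_ring_ideal_mult[OF P] prime_ring_ideal_power[OF P] by blast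
  qed
  \<comment> \<open>When \<open>p\<close> divides its slope, \<open>L\<close> reduces modulo
    \<open>p\<close> to its constant term.\<close>
  have lin: "p dvd int n * (1 - c)" if "p dvd (int n + 1) * m ^ 2"
  proof -
    have "[:int n * (1 - c):] = [:(int n + 1) * m ^ 2:] * [:0, 1:] - L" by (simp add: L_def)
    then show ?thesis using LP constI[OF that] idl_intros const by metis
  qed
  have npm: "\<not> p dvd m"
  proof
    assume pm: "p dvd m"
    then have "p dvd c" using dvd_trans[OF pm dvd_power[of "2 * n" m]] n by (simp add: c_def)
    moreover have "p dvd int n * (1 - c)" using lin pm by (simp add: power2_eq_square)
    ultimately have "p dvd int n"
      using p by (metis dvd_add_right_iff diff_add_cancel not_prime_unit prime_dvd_mult_iff)
    then show False using pm nm p by (meson coprime_common_divisor not_prime_unit)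
  qed
  have npD: "\<not> p ^ 2 dvd D_val n b m"
    using square_dvd_d_val[of b m p n] nonunit[OF d] p npb npm b m by (auto simp: prime_dvd_mult_iff)
  \<comment> \<open>The square of \<open>u\<close> is the denominator of
    \<open>D_val\<close>.\<close>
  define u where "u = 1 + c * int n"
  have "c > 0" using b m by (simp add: c_def power_mult)
  then have u0: "u \<noteq> 0" by (simp add: u_def add_pos_nonneg less_imp_neq[symmetric])
  have npN: "\<not> p dvd int n + 1"
  proof
    assume pN: "p dvd int n + 1"
    then have "p dvd int n * (1 - c)" using lin by simp
    moreover have "\<not> p dvd int n" using pN p by (metis dvd_add_right_iff not_prime_unit)
    ultimately have "p dvd 1 - c" using p by (simp add: prime_dvd_mult_iff)
    then show False
      using square_dvd_D_val[OF n p pN] u0 npD by (simp add: u_def c_def)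
  qed
  define a where "a = (int n + 1) * m ^ 2"
  have pa: "\<not> p dvd a" using npN npm p by (auto simp: a_def prime_dvd_mult_iff prime_dvd_power_iff)
  then have "coprime a (p ^ 2)" using p by (metis coprime_commute coprime_power_right_iff prime_imp_coprime)
  \<comment> \<open>\<open>s\<close> inverts the slope \<open>a\<close> of \<open>L\<close> modulo
    \<open>p ^ 2\<close>, so \<open>r\<close> below is a root of \<open>L\<close> modulo
    \<open>p ^ 2\<close>; precision beyond \<open>p\<close> is required for the final
    substitution.\<close>
  then obtain s v where sv: "s * a + v * p ^ 2 = 1" by (metis bezout_int coprime_imp_gcd_eq_1)
  define r where "r = s * (int n * (1 - c))"
  have "a * r - int n * (1 - c) = (s * a + v * p ^ 2 - 1) * (int n * (1 - c)) - p ^ 2 * (v * (int n * (1 - c)))"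
    unfolding r_def by (simp add: algebra_simps)
  also have "\<dots> = - (p ^ 2 * (v * (int n * (1 - c))))" using sv by simp
  finally have r: "p ^ 2 dvd a * r - int n * (1 - c)" by simp
  have pr: "p dvd a * r - int n * (1 - c)" using r by (metis dvd_trans dvd_triv_left power2_eq_square)
  have rP: "[:- r, 1:] \<in> P"
  proof -
    have "[:a:] * [:- r, 1:] = L - [:a * r - int n * (1 - c):]" by (simp add: L_def a_def)
    then have "[:a:] * [:- r, 1:] \<in> P" using LP constI[OF pr] idl_intros by metis
    then show ?thesis using prime_ring_ideal_mult[OF P] pa const by blast
  qed
  have npu: "\<not> p dvd u"
  proof
    \<comment> \<open>Then \<open>m ^ 2 * r\<close> is 1 modulo \<open>p\<close>, so
      \<open>m ^ 2 * x - 1\<close> lies in \<open>P\<close> too. Differentiating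
      \<open>deriv\<close> once more leaves \<open>a * x ^ (n - 1)\<close> as the only term not yet
      known to be in \<open>P\<close>, yet neither \<open>a\<close> nor \<open>x\<close> is in
      \<open>P\<close>.\<close>
    assume "p dvd u"
    have "(int n + 1) * (m ^ 2 * r - 1) = (a * r - int n * (1 - c)) - u"
      by (simp add: a_def u_def algebra_simps)
    then have "p dvd (int n + 1) * (m ^ 2 * r - 1)" using pr \<open>p dvd u\<close> by simp
    then have "p dvd m ^ 2 * r - 1" using npN p by (simp add: prime_dvd_mult_iff)
    moreover have "[:- 1, m ^ 2:] = [:m ^ 2:] * [:- r, 1:] + [:m ^ 2 * r - 1:]" by simp
    ultimately have xP': "[:- 1, m ^ 2:] \<in> P" using rP constI idl_intros by metis
    have "pderiv (smult (m ^ 2) f + [:- 1, m ^ 2:] * pderiv f) = pderiv (monom 1 (n - 1) * L)"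
      unfolding deriv ..
    then have "monom 1 (n - 1) * [:a:] + L * pderiv (monom 1 (n - 1))
        = [:m ^ 2:] * pderiv f + ([:- 1, m ^ 2:] * pderiv (pderiv f) + pderiv f * [:m ^ 2:])"
      by (simp only: pderiv_mult pderiv_add) (simp add: pderiv_smult pderiv_pCons L_def a_def)
    then have "[:0, 1:] ^ (n - 1) * [:a:] = [:m ^ 2:] * pderiv f
        + ([:- 1, m ^ 2:] * pderiv (pderiv f) + pderiv f * [:m ^ 2:]) - L * pderiv (monom 1 (n - 1))"
      by (simp add: monom_altdef eq_diff_eq)
    then have "[:0, 1:] ^ (n - 1) * [:a:] \<in> P" using f'P LP xP' idl_intros by metis
    then show False
      using xP pa const prime_ring_ideal_mult[OF P] prime_ring_ideal_power[OF P] by blast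
  qed
  let ?B = "int n * (1 - c)"
  have "p ^ 2 dvd (m ^ 2 * r - 1) * poly f r" using at_root[OF rP] by simp
  also have "(m ^ 2 * r - 1) * poly f r = poly ([:- 1, m ^ 2:] * f) r"
    by (simp add: algebra_simps)
  also have "\<dots> = m ^ 2 * r ^ (n + 1) - (1 - c) * r ^ n - b"
    unfolding f_def F_poly_trinomial by (simp add: c_def poly_monom mult.commute)
  \<comment> \<open>The multiplier makes \<open>r\<close> occur only in the product
    \<open>a * r\<close>, which is \<open>n * (1 - c)\<close> modulo \<open>p ^ 2\<close>.\<close>
  finally have "p ^ 2 dvd ((int n + 1) ^ (n + 1) * m ^ (2 * n)) * (m ^ 2 * r ^ (n + 1) - (1 - c) * r ^ n - b)"
    by simp
  also have "((int n + 1) ^ (n + 1) * m ^ (2 * n)) * (m ^ 2 * r ^ (n + 1) - (1 - c) * r ^ n - b)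
      = (a * r) ^ (n + 1) - (int n + 1) * (1 - c) * (a * r) ^ n - c * (int n + 1) ^ (n + 1)"
  proof -
    have pow_n: "(a * r) ^ n = (int n + 1) ^ n * m ^ (2 * n) * r ^ n"
      by (simp add: a_def power_mult_distrib power_mult)
    have "(a * r) ^ (n + 1) = (int n + 1) * m ^ 2 * r * (a * r) ^ n" by (simp add: a_def)
    then show ?thesis unfolding pow_n c_def by (simp add: algebra_simps)
  qed
  finally have 1: "p ^ 2 dvd (a * r) ^ (n + 1) - (int n + 1) * (1 - c) * (a * r) ^ n - c * (int n + 1) ^ (n + 1)" .
  have pow: "p ^ 2 dvd (a * r) ^ i - ?B ^ i" for i
    using r dvd_trans by (metis dvd_def power_diff_sumr2)
  \<comment> \<open>Replacing \<open>a * r\<close> by \<open>?B\<close> in the trinomial value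
    yields minus the numerator of \<open>D_val\<close>.\<close>
  have "- ((int n ^ n * (1 - c) ^ (n + 1)) + c * (int n + 1) ^ (n + 1))
      = ?B ^ (n + 1) - (int n + 1) * (1 - c) * ?B ^ n - c * (int n + 1) ^ (n + 1)"
  proof -
    have pow_n: "?B ^ n = int n ^ n * (1 - c) ^ n" by (rule power_mult_distrib)
    have "?B ^ (n + 1) = int n * (1 - c) * ?B ^ n" by simp
    then show ?thesis unfolding pow_n by (simp add: algebra_simps)
  qed
  also have "\<dots> = ((a * r) ^ (n + 1) - (int n + 1) * (1 - c) * (a * r) ^ n - c * (int n + 1) ^ (n + 1))
      - ((a * r) ^ (n + 1) - ?B ^ (n + 1)) + (int n + 1) * (1 - c) * ((a * r) ^ n - ?B ^ n)"
    by (simp add: right_diff_distrib)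
  finally have "p ^ 2 dvd - ((int n ^ n * (1 - c) ^ (n + 1)) + c * (int n + 1) ^ (n + 1))"
    using dvd_add[OF dvd_diff[OF 1 pow[of "n + 1"]] dvd_mult[OF pow[of n]]] by metis
  then have "p ^ 2 dvd int n ^ n * (1 - c) ^ (n + 1) + c * (int n + 1) ^ (n + 1)"
    by (simp only: dvd_minus_iff)
  then have "p ^ 2 dvd u ^ 2 * D_val n b m"
    using D_val_eq[OF u0[unfolded u_def c_def]] by (simp only: u_def c_def)
  moreover have "coprime (p ^ 2) (u ^ 2)"
    using npu p by (simp add: prime_imp_coprime)
  ultimately show False using npD by (simp add: coprime_dvd_mult_right_iff)
qed

theorem corollary1p4:
  fixes n :: nat and m b :: int
  assumes "n \<ge> 3" and "\<bar>m\<bar> \<ge> 2" and "b \<ge> 2"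
    and "gcd b m = 1" and "squarefree b"
    and "squarefree (d_val n b m)"
    and "gcd (int n) m = 1"
  shows "monogenic (F_poly n b m)"
proof (rule monogenicI)
  \<comment> \<open>This prime factor of \<open>b\<close> serves as the Eisenstein prime.\<close>
  obtain p where p: "prime p" "p dvd b"
    using prime_divisor_exists[of b] \<open>b \<ge> 2\<close> by auto
  show "lead_coeff (F_poly n b m) = 1" by (simp add: degree_F_poly coeff_F_poly)
  have "irreducible (F_poly n b m)" using irreducible_F_poly[OF _ p \<open>squarefree b\<close>] \<open>n \<ge> 3\<close> by simp
  then show "irreducible (map_poly rat_of_int (F_poly n b m))"
    using \<open>n \<ge> 3\<close> by (intro irreducible_map_poly_rat_of_int) (simp_all add: degree_F_poly)
next
  fix p P k l t
  assume prems: "prime p" "prime_ring_ideal P" "[:p:] \<in> P" "k \<in> P" "l \<in> P" "t \<in> P"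
    "F_poly n b m = k * l + [:p:] * t"
  have m: "m \<noteq> 0" and nm: "coprime (int n) m"
    using assms by (auto simp: coprime_iff_gcd_eq_1)
  show False
    by (rule F_poly_regular[OF assms(1,3) m assms(5,6) nm prems])
qed

end
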